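(* Let $D\in\mathcal R_2$, and let $A\subseteq D$ be Skula closed in the Scott space $\Sigma D$. Then $A$, equipped with the order inherited from $D$, belongs to $\mathcal R_2$.
   Context: Directed subsets are nonempty; a dcpo is a poset in which every directed subset has a supremum. $\mathbf{DCPO}$ is the category of dcpos and Scott-continuous maps. For dcpos $A,B$, $[A\to B]$ is the dcpo of Scott-continuous maps ordered pointwise. $\Sigma D$ denotes $D$ with its Scott topology. All full subcategories are closed under isomorphisms. The Skula topology on a $T_0$ space $X$ with specialization order $\le_X$ is the topology generated by the subbasis $\mathcal O(X)\cup\{{\downarrow}x:x\in X\}$, where $\mathcal O(X)$ is the set of open subsets of $X$ and ${\downarrow}x=\{y\in X:y\le_X x\}$. A subset is Skula closed if it is closed in the Skula topology. (For a dcpo $D$, the specialization order of $\Sigma D$ is the order of $D$.) Let $2=\{0<1\}$. $E_2$ is the class of all Scott-continuous maps $e:A\to B$ between dcpos such that $e^*:[B\to 2]\to[A\to 2]$, $g\mapsto g\circ e$, is an isomorphism of dcpos (equivalently, $e^{-1}$ is an order isomorphism from the lattice of Scott-open sets of $B$ onto that of $A$). $\mathcal R_2=E_2^{\perp}$ is the full subcategory of $\mathbf{DCPO}$ of all dcpos $C$ such that for every $e:A\to B$ in $E_2$ the map $e^*:[B\to C]\to[A\to C]$, $g\mapsto g\circ e$, is an isomorphism of dcpos. (It is the least reflective full subcategory of $\mathbf{DCPO}$ containing $2$.) *)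

theory Defs
  imports "HOL-Analysis.Analysis" "HOL-Algebra.Order"
begin

section \<open>Dcpos and Scott-continuous maps\<close>

definition directed :: "'a gorder \<Rightarrow> 'a set \<Rightarrow> bool" where
  "directed D S \<longleftrightarrow> S \<noteq> {} \<and> S \<subseteq> carrier D \<and>
     (\<forall>x\<in>S. \<forall>y\<in>S. \<exists>z\<in>S. x \<sqsubseteq>\<^bsub>D\<^esub> z \<and> y \<sqsubseteq>\<^bsub>D\<^esub> z)"

definition dcpo :: "'a gorder \<Rightarrow> bool" where
  "dcpo D \<longleftrightarrow> partial_order D \<and> (\<forall>S. directed D S \<longrightarrow> (\<exists>s. is_lub D s S))"

definition scott_continuous :: "'a gorder \<Rightarrow> 'b gorder \<Rightarrow> ('a \<Rightarrow> 'b) \<Rightarrow> bool" where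
  "scott_continuous A B f \<longleftrightarrow> f \<in> carrier A \<rightarrow> carrier B \<and>
     (\<forall>x\<in>carrier A. \<forall>y\<in>carrier A. x \<sqsubseteq>\<^bsub>A\<^esub> y \<longrightarrow> f x \<sqsubseteq>\<^bsub>B\<^esub> f y) \<and>
     (\<forall>S s. directed A S \<and> is_lub A s S \<longrightarrow> is_lub B (f s) (f ` S))"

definition dcpo_iso :: "'a gorder \<Rightarrow> 'b gorder \<Rightarrow> ('a \<Rightarrow> 'b) \<Rightarrow> bool" where
  "dcpo_iso A B f \<longleftrightarrow> scott_continuous A B f \<and>
     (\<exists>g. scott_continuous B A g \<and>
          (\<forall>x\<in>carrier A. g (f x) = x) \<and> (\<forall>y\<in>carrier B. f (g y) = y))"

text \<open>
  The dcpo \<open>[A \<rightarrow> B]\<close>. Its elements are extensional functions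
  (\<open>undefined\<close> outside \<open>carrier A\<close>), so that two of them are equal in HOL
  iff they agree on \<open>carrier A\<close>.
\<close>

definition scott_fun :: "'a gorder \<Rightarrow> 'b gorder \<Rightarrow> ('a \<Rightarrow> 'b) gorder" where
  "scott_fun A B =
     \<lparr> carrier = {f \<in> carrier A \<rightarrow>\<^sub>E carrier B. scott_continuous A B f},
       eq = (=),
       le = (\<lambda>f g. \<forall>x\<in>carrier A. f x \<sqsubseteq>\<^bsub>B\<^esub> g x) \<rparr>"

definition precomp :: "'a gorder \<Rightarrow> ('a \<Rightarrow> 'b) \<Rightarrow> ('b \<Rightarrow> 'c) \<Rightarrow> ('a \<Rightarrow> 'c)" where
  "precomp A e = (\<lambda>g. compose (carrier A) g e)"

text \<open>The two-element chain \<open>0 < 1\<close> is \<open>False < True\<close>.\<close>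

definition two :: "bool gorder" where
  "two = \<lparr> carrier = UNIV, eq = (=), le = (\<le>) \<rparr>"

section \<open>The classes \<open>E\<^sub>2\<close> and \<open>\<R>\<^sub>2\<close>\<close>

definition E2 :: "'a gorder \<Rightarrow> 'b gorder \<Rightarrow> ('a \<Rightarrow> 'b) \<Rightarrow> bool" where
  "E2 A B e \<longleftrightarrow> dcpo A \<and> dcpo B \<and> scott_continuous A B e \<and>
     dcpo_iso (scott_fun B two) (scott_fun A two) (precomp A e)"

text \<open>
  HOL has no quantification over types inside a formula, so the maps \<open>e : A \<rightarrow> B\<close> that
  test membership in \<open>\<R>\<^sub>2\<close> range over all dcpos whose carriers are subsets of a type
  \<open>'u\<close>, which is a parameter independent of the type of \<open>C\<close>. Membership in the class
  \<open>\<R>\<^sub>2\<close> of the literature is \<open>R2 TYPE('u) C\<close> for every type \<open>'u\<close>.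
\<close>

definition R2 :: "'u itself \<Rightarrow> 'c gorder \<Rightarrow> bool" where
  "R2 U C \<longleftrightarrow> dcpo C \<and>
     (\<forall>(A :: 'u gorder) (B :: 'u gorder) e.
        E2 A B e \<longrightarrow> dcpo_iso (scott_fun B C) (scott_fun A C) (precomp A e))"

section \<open>Scott and Skula topologies\<close>

definition scott_open :: "'a gorder \<Rightarrow> 'a set \<Rightarrow> bool" where
  "scott_open D U \<longleftrightarrow> U \<subseteq> carrier D \<and>
     (\<forall>x\<in>U. \<forall>y\<in>carrier D. x \<sqsubseteq>\<^bsub>D\<^esub> y \<longrightarrow> y \<in> U) \<and>
     (\<forall>S s. directed D S \<and> is_lub D s S \<and> s \<in> U \<longrightarrow> S \<inter> U \<noteq> {})"

definition scott_topology :: "'a gorder \<Rightarrow> 'a topology" where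
  "scott_topology D = topology (scott_open D)"

definition specialization_le :: "'a topology \<Rightarrow> 'a \<Rightarrow> 'a \<Rightarrow> bool" where
  "specialization_le X x y \<longleftrightarrow> x \<in> Abstract_Topology.closure_of X {y}"

definition skula_topology :: "'a topology \<Rightarrow> 'a topology" where
  "skula_topology X = topology_generated_by
     ({U. openin X U} \<union> {{y \<in> topspace X. specialization_le X y x} | x. x \<in> topspace X})"

lemma istopology_scott_open: "istopology (scott_open D)"
  unfolding istopology_def
proof (intro conjI allI impI)
  fix U V assume U: "scott_open D U" and V: "scott_open D V"
  have "S \<inter> (U \<inter> V) \<noteq> {}" if S: "directed D S" "is_lub D s S" "s \<in> U \<inter> V" for S s
  proof -
    obtain x y where "x \<in> S" "x \<in> U" "y \<in> S" "y \<in> V"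
      using U V S unfolding scott_open_def by blast
    moreover then obtain z where "z \<in> S" "x \<sqsubseteq>\<^bsub>D\<^esub> z" "y \<sqsubseteq>\<^bsub>D\<^esub> z"
      using S(1) unfolding directed_def by blast
    moreover have "z \<in> carrier D"
      using S(1) \<open>z \<in> S\<close> unfolding directed_def by blast
    moreover have "z \<in> U"
      using U \<open>x \<in> U\<close> \<open>z \<in> carrier D\<close> \<open>x \<sqsubseteq>\<^bsub>D\<^esub> z\<close> unfolding scott_open_def by blast
    moreover have "z \<in> V"
      using V \<open>y \<in> V\<close> \<open>z \<in> carrier D\<close> \<open>y \<sqsubseteq>\<^bsub>D\<^esub> z\<close> unfolding scott_open_def by blast
    ultimately show ?thesis by blast
  qed
  then show "scott_open D (U \<inter> V)"
    using U V unfolding scott_open_def by blast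
next
  fix \<K> assume K: "\<forall>K\<in>\<K>. scott_open D K"
  have "S \<inter> \<Union>\<K> \<noteq> {}" if S: "directed D S" "is_lub D s S" "s \<in> \<Union>\<K>" for S s
  proof -
    obtain K where "K \<in> \<K>" "s \<in> K" using S(3) by blast
    then have "S \<inter> K \<noteq> {}" using K S(1,2) unfolding scott_open_def by blast
    then show ?thesis using \<open>K \<in> \<K>\<close> by blast
  qed
  then show "scott_open D (\<Union>\<K>)"
    using K unfolding scott_open_def by (simp add: Sup_le_iff) blast
qed

lemma openin_scott_topology: "openin (scott_topology D) U \<longleftrightarrow> scott_open D U"
  by (simp add: scott_topology_def istopology_scott_open topology_inverse')

lemma topspace_scott_topology: "topspace (scott_topology D) = carrier D"
proof -
  have "scott_open D (carrier D)"
    unfolding scott_open_def directed_def by blast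
  then show ?thesis
    using openin_subset[of "scott_topology D" "carrier D"] openin_topspace[of "scott_topology D"]
    unfolding openin_scott_topology by (auto simp: scott_open_def)
qed

lemma scott_open_not_below:
  assumes "partial_order D" "y \<in> carrier D"
  shows "scott_open D {x \<in> carrier D. \<not> x \<sqsubseteq>\<^bsub>D\<^esub> y}"
proof -
  interpret partial_order D by fact
  let ?U = "{x \<in> carrier D. \<not> x \<sqsubseteq>\<^bsub>D\<^esub> y}"
  have "S \<inter> ?U \<noteq> {}" if S: "directed D S" "is_lub D s S" "s \<in> ?U" for S s
  proof
    assume "S \<inter> ?U = {}"
    then have "y \<in> Upper D S"
      using S(1) assms(2) unfolding directed_def Upper_def by blast
    then show False
      using S(2,3) unfolding least_def by blast
  qed
  moreover have "\<not> z \<sqsubseteq>\<^bsub>D\<^esub> y" if "x \<in> ?U" "z \<in> carrier D" "x \<sqsubseteq>\<^bsub>D\<^esub> z" for x z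
    using that assms(2) le_trans by blast
  ultimately show ?thesis
    unfolding scott_open_def by blast
qed

lemma specialization_le_scott_topology:
  assumes "partial_order D" "x \<in> carrier D" "y \<in> carrier D"
  shows "specialization_le (scott_topology D) x y \<longleftrightarrow> x \<sqsubseteq>\<^bsub>D\<^esub> y"
proof -
  interpret partial_order D by fact
  have eq: "specialization_le (scott_topology D) x y \<longleftrightarrow>
      (\<forall>U. x \<in> U \<and> scott_open D U \<longrightarrow> y \<in> U)"
    using assms(2) by (simp add: specialization_le_def in_closure_of openin_scott_topology
        topspace_scott_topology)
  show ?thesis
  proof
    assume "specialization_le (scott_topology D) x y"
    then have *: "x \<in> U \<Longrightarrow> scott_open D U \<Longrightarrow> y \<in> U" for U
      unfolding eq by blast
    show "x \<sqsubseteq>\<^bsub>D\<^esub> y"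
      using *[OF _ scott_open_not_below[OF assms(1,3)]] assms(2,3) by auto
  next
    assume "x \<sqsubseteq>\<^bsub>D\<^esub> y"
    then have "y \<in> U" if "x \<in> U" "scott_open D U" for U
      using that assms(3) unfolding scott_open_def by blast
    then show "specialization_le (scott_topology D) x y"
      unfolding eq by blast
  qed
qed

end

theory Submission
  imports Defs
begin

text \<open>
  A Skula closed set is an intersection of sets \<open>(carrier D - U) \<union> V\<close> with \<open>U\<close>, \<open>V\<close> Scott open.
  Such a set is closed under directed suprema, so a map \<open>f : X \<rightarrow> A\<close> extends along
  \<open>e : X \<rightarrow> Y\<close> to a map \<open>g : Y \<rightarrow> D\<close>. For each pair \<open>(U, V)\<close>, the inclusion \<open>A \<inter> U \<subseteq> V\<close> gives
  \<open>e\<^sup>-\<^sup>1(g\<^sup>-\<^sup>1(U)) \<subseteq> e\<^sup>-\<^sup>1(g\<^sup>-\<^sup>1(V))\<close>, hence \<open>g\<^sup>-\<^sup>1(U) \<subseteq> g\<^sup>-\<^sup>1(V)\<close> because \<open>e\<close> lies in \<open>E\<^sub>2\<close>. So \<open>g\<close> takes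
  its values in \<open>A\<close>.
\<close>

section \<open>Suprema, subposets and function spaces\<close>

lemma is_lubI:
  assumes "s \<in> carrier D" "S \<subseteq> carrier D" "\<And>x. x \<in> S \<Longrightarrow> x \<sqsubseteq>\<^bsub>D\<^esub> s"
    and "\<And>y. y \<in> carrier D \<Longrightarrow> (\<And>x. x \<in> S \<Longrightarrow> x \<sqsubseteq>\<^bsub>D\<^esub> y) \<Longrightarrow> s \<sqsubseteq>\<^bsub>D\<^esub> y"
  shows "is_lub D s S"
  using assms(1-3) by (auto simp: least_def Upper_def dest: subsetD intro: assms(4))

lemma is_lub_in_carrier: "is_lub D s S \<Longrightarrow> s \<in> carrier D"
  unfolding least_def Upper_def by auto

lemma is_lub_upper: "is_lub D s S \<Longrightarrow> x \<in> S \<Longrightarrow> S \<subseteq> carrier D \<Longrightarrow> x \<sqsubseteq>\<^bsub>D\<^esub> s"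
  unfolding least_def Upper_def by auto

lemma is_lub_least:
  "is_lub D s S \<Longrightarrow> y \<in> carrier D \<Longrightarrow> (\<And>x. x \<in> S \<Longrightarrow> x \<sqsubseteq>\<^bsub>D\<^esub> y) \<Longrightarrow> s \<sqsubseteq>\<^bsub>D\<^esub> y"
  unfolding least_def Upper_def by auto

lemma directed_subset: "directed D S \<Longrightarrow> S \<subseteq> carrier D"
  unfolding directed_def by blast

lemma partial_order_subset:
  assumes "partial_order D" "A \<subseteq> carrier D"
  shows "partial_order (D\<lparr>carrier := A\<rparr>)"
proof -
  interpret partial_order D by fact
  show ?thesis
    by unfold_locales (use assms(2) in \<open>auto simp: eq_is_equal intro: le_trans dest: subsetD\<close>)
qed

text \<open>Antisymmetry is where extensionality enters: maps that agree on \<open>carrier A\<close>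
  are equal in HOL because both are \<open>undefined\<close> elsewhere.\<close>

lemma partial_order_scott_fun:
  assumes "partial_order B"
  shows "partial_order (scott_fun A B)"
proof -
  interpret partial_order B by fact
  show ?thesis
  proof unfold_locales
    fix f g
    assume "f \<sqsubseteq>\<^bsub>scott_fun A B\<^esub> g" "g \<sqsubseteq>\<^bsub>scott_fun A B\<^esub> f"
      and "f \<in> carrier (scott_fun A B)" "g \<in> carrier (scott_fun A B)"
    then have "f x \<sqsubseteq>\<^bsub>B\<^esub> g x \<and> g x \<sqsubseteq>\<^bsub>B\<^esub> f x" if "x \<in> carrier A" for x
      using that by (simp add: scott_fun_def)
    moreover have fg: "f \<in> carrier A \<rightarrow>\<^sub>E carrier B" "g \<in> carrier A \<rightarrow>\<^sub>E carrier B"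
      using \<open>f \<in> carrier (scott_fun A B)\<close> \<open>g \<in> carrier (scott_fun A B)\<close>
      by (simp_all add: scott_fun_def)
    ultimately have "f = g"
      by (intro PiE_ext[OF fg] le_antisym) (auto dest: PiE_mem)
    then show "f .=\<^bsub>scott_fun A B\<^esub> g" by (simp add: scott_fun_def)
  next
    fix f g h
    assume "f \<sqsubseteq>\<^bsub>scott_fun A B\<^esub> g" "g \<sqsubseteq>\<^bsub>scott_fun A B\<^esub> h"
      and "f \<in> carrier (scott_fun A B)" "g \<in> carrier (scott_fun A B)" "h \<in> carrier (scott_fun A B)"
    then show "f \<sqsubseteq>\<^bsub>scott_fun A B\<^esub> h"
      unfolding scott_fun_def by simp (meson PiE_mem le_trans)
  qed (auto simp: scott_fun_def)
qed

section \<open>Isomorphisms of dcpos as order isomorphisms\<close>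

lemma scott_continuous_order_iso:
  assumes f: "f \<in> carrier P \<rightarrow> carrier Q" and g: "g \<in> carrier Q \<rightarrow> carrier P"
    and fmono: "\<And>x y. x \<in> carrier P \<Longrightarrow> y \<in> carrier P \<Longrightarrow> x \<sqsubseteq>\<^bsub>P\<^esub> y \<Longrightarrow> f x \<sqsubseteq>\<^bsub>Q\<^esub> f y"
    and gmono: "\<And>x y. x \<in> carrier Q \<Longrightarrow> y \<in> carrier Q \<Longrightarrow> x \<sqsubseteq>\<^bsub>Q\<^esub> y \<Longrightarrow> g x \<sqsubseteq>\<^bsub>P\<^esub> g y"
    and gf: "\<And>x. x \<in> carrier P \<Longrightarrow> g (f x) = x" and fg: "\<And>y. y \<in> carrier Q \<Longrightarrow> f (g y) = y"
  shows "scott_continuous P Q f"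
proof -
  have "is_lub Q (f s) (f ` S)" if S: "directed P S" "is_lub P s S" for S s
  proof (rule is_lubI)
    have SP: "S \<subseteq> carrier P" using S(1) by (rule directed_subset)
    have sP: "s \<in> carrier P" using S(2) by (rule is_lub_in_carrier)
    show "f s \<in> carrier Q" "f ` S \<subseteq> carrier Q" using f SP sP by auto
    show "y \<sqsubseteq>\<^bsub>Q\<^esub> f s" if "y \<in> f ` S" for y
      using that is_lub_upper[OF S(2) _ SP] SP sP fmono by blast
    fix y assume y: "y \<in> carrier Q" and upper: "\<And>x. x \<in> f ` S \<Longrightarrow> x \<sqsubseteq>\<^bsub>Q\<^esub> y"
    have gy: "g y \<in> carrier P" using g y by auto
    have "s \<sqsubseteq>\<^bsub>P\<^esub> g y"
    proof (rule is_lub_least[OF S(2) gy])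
      fix x assume x: "x \<in> S"
      then have "g (f x) \<sqsubseteq>\<^bsub>P\<^esub> g y" using f SP y upper by (intro gmono) auto
      then show "x \<sqsubseteq>\<^bsub>P\<^esub> g y" using gf x SP by auto
    qed
    then show "f s \<sqsubseteq>\<^bsub>Q\<^esub> y" using fmono[OF sP gy] fg[OF y] by simp
  qed
  then show ?thesis using f fmono unfolding scott_continuous_def by blast
qed

lemma scott_continuous_mono:
  "scott_continuous A B f \<Longrightarrow> x \<in> carrier A \<Longrightarrow> y \<in> carrier A \<Longrightarrow> x \<sqsubseteq>\<^bsub>A\<^esub> y \<Longrightarrow> f x \<sqsubseteq>\<^bsub>B\<^esub> f y"
  unfolding scott_continuous_def by blast

text \<open>This removes continuity from the notion of isomorphism: a surjective order embedding has
  a monotone inverse, and mutually inverse monotone maps preserve suprema. Membership in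
  \<open>E2\<close> and \<open>R2\<close> thus becomes a matter of surjectivity and order reflection
  for \<open>precomp\<close>.\<close>

lemma dcpo_iso_iff:
  assumes "partial_order P"
  shows "dcpo_iso P Q f \<longleftrightarrow> f ` carrier P = carrier Q \<and>
    (\<forall>x\<in>carrier P. \<forall>y\<in>carrier P. x \<sqsubseteq>\<^bsub>P\<^esub> y \<longleftrightarrow> f x \<sqsubseteq>\<^bsub>Q\<^esub> f y)" (is "?L \<longleftrightarrow> ?R")
proof
  assume ?L
  then obtain g where f: "scott_continuous P Q f" and g: "scott_continuous Q P g"
    and gf: "\<forall>x\<in>carrier P. g (f x) = x" and fg: "\<forall>y\<in>carrier Q. f (g y) = y"
    unfolding dcpo_iso_def by blast
  have fP: "f \<in> carrier P \<rightarrow> carrier Q" and gQ: "g \<in> carrier Q \<rightarrow> carrier P"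
    using f g unfolding scott_continuous_def by auto
  have "f ` carrier P = carrier Q"
    using fP gQ fg by (metis PiE image_eqI image_subset_iff_funcset subsetI subset_antisym)
  moreover have "x \<sqsubseteq>\<^bsub>P\<^esub> y" if "x \<in> carrier P" "y \<in> carrier P" "f x \<sqsubseteq>\<^bsub>Q\<^esub> f y" for x y
    using scott_continuous_mono[OF g, of "f x" "f y"] that gf fP by auto
  ultimately show ?R using scott_continuous_mono[OF f] by blast
next
  interpret partial_order P by fact
  assume R: ?R
  \<comment> \<open>If \<open>f x = f y\<close>, reflexivity at \<open>x\<close> and at
    \<open>y\<close> gives both inequalities between the images; the embedding reflects them, and
    antisymmetry yields \<open>x = y\<close>.\<close>
  have inj: "inj_on f (carrier P)"
    using R le_refl by (intro inj_onI le_antisym) auto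
  define g where "g = inv_into (carrier P) f"
  have fP: "f \<in> carrier P \<rightarrow> carrier Q" using R by auto
  have gQ: "g \<in> carrier Q \<rightarrow> carrier P" using R unfolding g_def by (auto intro: inv_into_into)
  have gf: "g (f x) = x" if "x \<in> carrier P" for x using inj that by (simp add: g_def)
  have fg: "f (g y) = y" if "y \<in> carrier Q" for y using R that unfolding g_def by (simp add: f_inv_into_f)
  have fmono: "f x \<sqsubseteq>\<^bsub>Q\<^esub> f y" if "x \<in> carrier P" "y \<in> carrier P" "x \<sqsubseteq>\<^bsub>P\<^esub> y" for x y
    using R that by blast
  have gmono: "g x \<sqsubseteq>\<^bsub>P\<^esub> g y" if "x \<in> carrier Q" "y \<in> carrier Q" "x \<sqsubseteq>\<^bsub>Q\<^esub> y" for x y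
  proof -
    have "g x \<in> carrier P" "g y \<in> carrier P" using gQ that by auto
    then show ?thesis using R that fg by simp
  qed
  show ?L
    unfolding dcpo_iso_def
  proof (intro conjI exI[of _ g] ballI)
    show "scott_continuous P Q f"
      by (rule scott_continuous_order_iso[OF fP gQ fmono gmono gf fg])
    show "scott_continuous Q P g"
      by (rule scott_continuous_order_iso[OF gQ fP gmono fmono fg gf])
  qed (simp_all add: gf fg)
qed

section \<open>Scott-continuous maps and Scott-open sets\<close>

lemma directed_image:
  assumes "scott_continuous A B f" "directed A S"
  shows "directed B (f ` S)"
proof -
  have "S \<subseteq> carrier A" "S \<noteq> {}" using assms(2) unfolding directed_def by blast+
  moreover have "f ` carrier A \<subseteq> carrier B" using assms(1) unfolding scott_continuous_def by blast
  moreover have "\<exists>z\<in>S. f x \<sqsubseteq>\<^bsub>B\<^esub> f z \<and> f y \<sqsubseteq>\<^bsub>B\<^esub> f z" if xy: "x \<in> S" "y \<in> S" for x y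
  proof -
    obtain z where "z \<in> S" "x \<sqsubseteq>\<^bsub>A\<^esub> z" "y \<sqsubseteq>\<^bsub>A\<^esub> z"
      using assms(2) xy unfolding directed_def by blast
    then show ?thesis
      using scott_continuous_mono[OF assms(1)] xy \<open>S \<subseteq> carrier A\<close> by (meson subsetD)
  qed
  ultimately show ?thesis unfolding directed_def by blast
qed

lemma scott_open_vimage:
  assumes f: "scott_continuous Y D f" and U: "scott_open D U"
  shows "scott_open Y {y \<in> carrier Y. f y \<in> U}"
proof -
  have "S \<inter> {y \<in> carrier Y. f y \<in> U} \<noteq> {}"
    if S: "directed Y S" "is_lub Y s S" "s \<in> {y \<in> carrier Y. f y \<in> U}" for S s
  proof -
    have "is_lub D (f s) (f ` S)" using f S(1,2) unfolding scott_continuous_def by blast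
    then have "f ` S \<inter> U \<noteq> {}"
      using U directed_image[OF f S(1)] S(3) unfolding scott_open_def by blast
    then show ?thesis using directed_subset[OF S(1)] by blast
  qed
  moreover have "f y \<in> U" if "x \<in> carrier Y" "f x \<in> U" "y \<in> carrier Y" "x \<sqsubseteq>\<^bsub>Y\<^esub> y" for x y
  proof -
    have "f y \<in> carrier D" using f that(3) unfolding scott_continuous_def by blast
    then show ?thesis
      using U that(2) scott_continuous_mono[OF f that(1,3,4)] unfolding scott_open_def by blast
  qed
  ultimately show ?thesis unfolding scott_open_def by blast
qed

text \<open>Turns Scott-open sets into elements of \<open>scott_fun D two\<close>, on which the
  definition of \<open>E2\<close> can act. The \<open>restrict\<close> makes the characteristic map
  extensional.\<close>

lemma scott_continuous_two:
  assumes "scott_open D U"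
  shows "scott_continuous D two (restrict (\<lambda>x. x \<in> U) (carrier D))"
proof -
  let ?\<chi> = "restrict (\<lambda>x. x \<in> U) (carrier D)"
  have "is_lub two (?\<chi> s) (?\<chi> ` S)" if S: "directed D S" "is_lub D s S" for S s
  proof (rule is_lubI)
    have SD: "S \<subseteq> carrier D" and s: "s \<in> carrier D"
      using directed_subset[OF S(1)] is_lub_in_carrier[OF S(2)] .
    show "b \<sqsubseteq>\<^bsub>two\<^esub> ?\<chi> s" if "b \<in> ?\<chi> ` S" for b
      using that SD s is_lub_upper[OF S(2) _ SD] assms unfolding scott_open_def two_def
      by auto
    show "?\<chi> s \<sqsubseteq>\<^bsub>two\<^esub> b" if upper: "\<And>c. c \<in> ?\<chi> ` S \<Longrightarrow> c \<sqsubseteq>\<^bsub>two\<^esub> b" for b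
    proof -
      \<comment> \<open>A Scott-open set containing the supremum \<open>s\<close> already meets the
        directed set \<open>S\<close>, so some member of the image is \<open>True\<close> and forces
        \<open>b\<close>.\<close>
      have b if sU: "s \<in> U"
      proof -
        obtain x where x: "x \<in> S" "x \<in> U" using assms S sU unfolding scott_open_def by blast
        then have "?\<chi> x \<sqsubseteq>\<^bsub>two\<^esub> b" using upper by blast
        then show b using x SD by (auto simp: two_def)
      qed
      then show ?thesis using s by (simp add: two_def)
    qed
  qed (auto simp: two_def)
  then show ?thesis
    using assms unfolding scott_continuous_def by (auto simp: two_def scott_open_def)
qed

section \<open>Precomposition and maps in \<open>E2\<close>\<close>

lemma scott_continuous_compose:
  assumes "scott_continuous A B e" "scott_continuous B C g"
  shows "scott_continuous A C (compose (carrier A) g e)"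
proof -
  have "is_lub C (compose (carrier A) g e s) (compose (carrier A) g e ` S)"
    if S: "directed A S" "is_lub A s S" for S s
  proof -
    have "is_lub C (g (e s)) (g ` e ` S)"
      using assms S directed_image[OF assms(1) S(1)] unfolding scott_continuous_def by blast
    moreover have "compose (carrier A) g e ` S = g ` e ` S"
      using directed_subset[OF S(1)] by (force simp: compose_def)
    ultimately show ?thesis using is_lub_in_carrier[OF S(2)] by (simp add: compose_def)
  qed
  then show ?thesis
    using assms unfolding scott_continuous_def by (auto simp: compose_def Pi_iff)
qed

lemma precomp_in_carrier:
  assumes "scott_continuous A B e" "g \<in> carrier (scott_fun B C)"
  shows "precomp A e g \<in> carrier (scott_fun A C)"
  using scott_continuous_compose[OF assms(1), of C g] assms
  by (auto simp: scott_fun_def precomp_def scott_continuous_def compose_def)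

lemma partial_order_two: "partial_order two"
  by unfold_locales (auto simp: two_def)

text \<open>The hypothesis \<open>sub\<close> compares the characteristic maps of \<open>U\<close>
  and \<open>V\<close> after precomposition with \<open>e\<close>. An isomorphism reflects the
  order, so the characteristic maps themselves are comparable.\<close>

lemma E2_scott_open_subset:
  assumes e: "E2 A B e" and U: "scott_open B U" and V: "scott_open B V"
    and sub: "\<And>x. x \<in> carrier A \<Longrightarrow> e x \<in> U \<Longrightarrow> e x \<in> V"
  shows "U \<subseteq> V"
proof -
  let ?\<chi> = "\<lambda>W. restrict (\<lambda>x. x \<in> W) (carrier B)"
  have e_fun: "e \<in> carrier A \<rightarrow> carrier B"
    using e unfolding E2_def scott_continuous_def by blast
  have \<chi>: "?\<chi> W \<in> carrier (scott_fun B two)" if "scott_open B W" for W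
    using scott_continuous_two[OF that] by (auto simp: scott_fun_def two_def)
  have "precomp A e (?\<chi> U) \<sqsubseteq>\<^bsub>scott_fun A two\<^esub> precomp A e (?\<chi> V)"
    using sub e_fun by (auto simp: scott_fun_def precomp_def compose_def two_def)
  moreover have "dcpo_iso (scott_fun B two) (scott_fun A two) (precomp A e)"
    using e unfolding E2_def by blast
  ultimately have "?\<chi> U \<sqsubseteq>\<^bsub>scott_fun B two\<^esub> ?\<chi> V"
    using \<chi>[OF U] \<chi>[OF V] by (simp add: dcpo_iso_iff partial_order_scott_fun partial_order_two)
  then have "\<forall>x\<in>carrier B. x \<in> U \<longrightarrow> x \<in> V"
    by (simp add: scott_fun_def two_def)
  then show ?thesis
    using U unfolding scott_open_def by blast
qed

section \<open>Separation in the Skula topology\<close>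

text \<open>Differences \<open>U - V\<close> of Scott-open sets form a base of the Skula topology;
  the conclusion says that \<open>z\<close> has such a neighbourhood inside \<open>W\<close>. The
  proof is by induction on the generation of \<open>W\<close> from the subbasis.\<close>

lemma skula_open_separation:
  assumes D: "partial_order D" and W: "openin (skula_topology (scott_topology D)) W" and z: "z \<in> W"
  obtains U V where "scott_open D U" "scott_open D V" "z \<in> U" "z \<notin> V" "U \<subseteq> W \<union> V"
proof -
  have "generate_topology_on ({U. openin (scott_topology D) U} \<union>
      {{y \<in> topspace (scott_topology D). specialization_le (scott_topology D) y x} | x.
        x \<in> topspace (scott_topology D)}) W"
    using W unfolding skula_topology_def openin_topology_generated_by_iff .
  then have "\<exists>U V. openin (scott_topology D) U \<and> openin (scott_topology D) V \<and>
      z \<in> U \<and> z \<notin> V \<and> U \<subseteq> W \<union> V"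
    using z
  proof (induction rule: generate_topology_on.induct)
    case Empty
    then show ?case by simp
  next
    case (Int a b)
    then obtain U1 V1 U2 V2 where
      "openin (scott_topology D) U1" "openin (scott_topology D) V1" "z \<in> U1" "z \<notin> V1" "U1 \<subseteq> a \<union> V1"
      "openin (scott_topology D) U2" "openin (scott_topology D) V2" "z \<in> U2" "z \<notin> V2" "U2 \<subseteq> b \<union> V2"
      by blast
    \<comment> \<open>A point of both \<open>U1\<close> and \<open>U2\<close> that avoids
      \<open>V1\<close> and \<open>V2\<close> lies in \<open>a\<close> and in
      \<open>b\<close>.\<close>
    then show ?case
      by (intro exI[of _ "U1 \<inter> U2"] exI[of _ "V1 \<union> V2"]) auto
  next
    case (UN K)
    then obtain k where "k \<in> K" "z \<in> k" by blast
    with UN.IH[OF this] show ?case by blast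
  next
    case (Basis s)
    then consider "openin (scott_topology D) s"
      | x where "x \<in> carrier D"
          "s = {y \<in> carrier D. specialization_le (scott_topology D) y x}"
      unfolding topspace_scott_topology by blast
    then show ?case
    proof cases
      case 1
      then show ?thesis using Basis.prems by (intro exI[of _ s] exI[of _ "{}"]) auto
    next
      case 2
      then have s: "s = {y \<in> carrier D. y \<sqsubseteq>\<^bsub>D\<^esub> x}"
        using specialization_le_scott_topology[OF D] by auto
      \<comment> \<open>A principal ideal is the whole carrier minus its Scott-open complement;
        these two sets serve as \<open>U\<close> and \<open>V\<close>.\<close>
      have "openin (scott_topology D) (carrier D)"
        by (metis openin_topspace topspace_scott_topology)
      moreover have "openin (scott_topology D) {y \<in> carrier D. \<not> y \<sqsubseteq>\<^bsub>D\<^esub> x}"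
        using scott_open_not_below[OF D 2(1)] by (simp add: openin_scott_topology)
      ultimately show ?thesis using Basis.prems s by blast
    qed
  qed
  then show thesis using that unfolding openin_scott_topology by blast
qed

text \<open>Apply the local form of Skula-open sets to the complement of \<open>A\<close>: a
  neighbourhood \<open>U - V\<close> of \<open>z\<close> that misses \<open>A\<close> means that
  \<open>A\<close> meets \<open>U\<close> only inside \<open>V\<close>.\<close>

lemma skula_closed_separation:
  assumes D: "partial_order D" and A: "closedin (skula_topology (scott_topology D)) A"
    and z: "z \<in> carrier D" "z \<notin> A"
  obtains U V where "scott_open D U" "scott_open D V" "z \<in> U" "z \<notin> V" "A \<inter> U \<subseteq> V"
proof -
  \<comment> \<open>The carrier is itself a generator, so every point of \<open>D\<close> belongs to
    the Skula space and \<open>z\<close> lies in the open complement of \<open>A\<close>.\<close>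
  have "openin (scott_topology D) (carrier D)"
    by (metis openin_topspace topspace_scott_topology)
  then have "z \<in> topspace (skula_topology (scott_topology D))"
    using z(1) unfolding skula_topology_def topology_generated_by_topspace by blast
  then have "z \<in> topspace (skula_topology (scott_topology D)) - A" using z(2) by blast
  with A obtain U V where "scott_open D U" "scott_open D V" "z \<in> U" "z \<notin> V"
    "U \<subseteq> (topspace (skula_topology (scott_topology D)) - A) \<union> V"
    unfolding closedin_def by (metis skula_open_separation[OF D])
  then show thesis using that by blast
qed

text \<open>If \<open>s\<close> were outside \<open>A\<close>, separate it by \<open>U\<close> and
  \<open>V\<close>. Some \<open>x\<close> in \<open>S\<close> lies in \<open>U\<close>, hence in
  \<open>V\<close>; as \<open>V\<close> is an upper set, \<open>s\<close> would lie in
  \<open>V\<close> too.\<close>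

lemma skula_closed_directed_sup:
  assumes D: "partial_order D" and A: "closedin (skula_topology (scott_topology D)) A"
    and S: "directed D S" "S \<subseteq> A" "is_lub D s S"
  shows "s \<in> A"
proof (rule ccontr)
  have sD: "s \<in> carrier D" using S(3) by (rule is_lub_in_carrier)
  assume "s \<notin> A"
  then obtain U V where U: "scott_open D U" and V: "scott_open D V" and s: "s \<in> U" "s \<notin> V"
    and AUV: "A \<inter> U \<subseteq> V"
    using skula_closed_separation[OF D A sD] by blast
  obtain x where x: "x \<in> S" "x \<in> U" using U S(1,3) s(1) unfolding scott_open_def by blast
  then have "x \<in> V" using AUV S(2) by blast
  moreover have "x \<sqsubseteq>\<^bsub>D\<^esub> s" using is_lub_upper[OF S(3) x(1) directed_subset[OF S(1)]] .
  ultimately show False using V s(2) sD unfolding scott_open_def by blast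
qed

section \<open>Subsets closed under directed suprema as dcpos\<close>

context
  fixes D :: "'d gorder" and A :: "'d set"
  assumes D: "dcpo D" and A: "A \<subseteq> carrier D"
    and closed: "\<forall>S s. directed D S \<and> S \<subseteq> A \<and> is_lub D s S \<longrightarrow> s \<in> A"
begin

lemma directed_subdcpo_iff: "directed (D\<lparr>carrier := A\<rparr>) S \<longleftrightarrow> directed D S \<and> S \<subseteq> A"
  using A unfolding directed_def by auto

text \<open>A supremum in \<open>D\<close> belongs to \<open>A\<close> by closure, so it is also the
  supremum in \<open>A\<close>. Conversely, \<open>D\<close> supplies some supremum
  \<open>t\<close>, and uniqueness in the subposet identifies it with \<open>s\<close>.\<close>

lemma is_lub_subdcpo_iff:
  assumes S: "directed D S" "S \<subseteq> A"
  shows "is_lub (D\<lparr>carrier := A\<rparr>) s S \<longleftrightarrow> is_lub D s S"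
proof -
  have po: "partial_order D" using D unfolding dcpo_def by blast
  have down: "is_lub (D\<lparr>carrier := A\<rparr>) t S" if t: "is_lub D t S" for t
  proof (rule is_lubI)
    have SD: "S \<subseteq> carrier D" using S(1) by (rule directed_subset)
    show "t \<in> carrier (D\<lparr>carrier := A\<rparr>)" "S \<subseteq> carrier (D\<lparr>carrier := A\<rparr>)"
      using closed S t by auto
    show "x \<sqsubseteq>\<^bsub>D\<lparr>carrier := A\<rparr>\<^esub> t" if "x \<in> S" for x
      using is_lub_upper[OF t that SD] by simp
    show "t \<sqsubseteq>\<^bsub>D\<lparr>carrier := A\<rparr>\<^esub> y"
      if "y \<in> carrier (D\<lparr>carrier := A\<rparr>)" "\<And>x. x \<in> S \<Longrightarrow> x \<sqsubseteq>\<^bsub>D\<lparr>carrier := A\<rparr>\<^esub> y" for y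
      using is_lub_least[OF t, of y] that A by auto
  qed
  show ?thesis
  proof
    assume s: "is_lub (D\<lparr>carrier := A\<rparr>) s S"
    obtain t where t: "is_lub D t S" using D S(1) unfolding dcpo_def by blast
    interpret sub: partial_order "D\<lparr>carrier := A\<rparr>"
      by (rule partial_order_subset[OF po A])
    have "s = t" using s down[OF t] by (rule sub.least_unique)
    then show "is_lub D s S" using t by simp
  qed (rule down)
qed

lemma dcpo_subdcpo: "dcpo (D\<lparr>carrier := A\<rparr>)"
  using D partial_order_subset[OF _ A]
  by (auto simp: dcpo_def directed_subdcpo_iff is_lub_subdcpo_iff)

text \<open>Holds because directed suprema of subsets of \<open>A\<close> agree in \<open>A\<close>
  and in \<open>D\<close>; the image of a directed set under \<open>f\<close> is such a
  subset.\<close>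

lemma scott_continuous_subdcpo_iff:
  "scott_continuous B (D\<lparr>carrier := A\<rparr>) f \<longleftrightarrow> scott_continuous B D f \<and> f \<in> carrier B \<rightarrow> A"
  (is "?L \<longleftrightarrow> ?R")
proof
  assume L: ?L
  have "is_lub D (f s) (f ` S)" if "directed B S" "is_lub B s S" for S s
  proof -
    have "directed D (f ` S)" "f ` S \<subseteq> A"
      using directed_image[OF L that(1)] unfolding directed_subdcpo_iff by auto
    moreover have "is_lub (D\<lparr>carrier := A\<rparr>) (f s) (f ` S)"
      using L that unfolding scott_continuous_def by blast
    ultimately show ?thesis by (simp add: is_lub_subdcpo_iff)
  qed
  then show ?R using L A unfolding scott_continuous_def by (auto simp: Pi_iff)
next
  assume R: ?R
  have "is_lub (D\<lparr>carrier := A\<rparr>) (f s) (f ` S)" if "directed B S" "is_lub B s S" for S s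
  proof -
    have "directed D (f ` S)" "f ` S \<subseteq> A"
      using R directed_image[of B D f, OF _ that(1)] directed_subset[OF that(1)] by auto
    moreover have "is_lub D (f s) (f ` S)"
      using R that unfolding scott_continuous_def by blast
    ultimately show ?thesis by (simp add: is_lub_subdcpo_iff)
  qed
  then show ?L using R unfolding scott_continuous_def by (auto simp: Pi_iff)
qed

text \<open>Places the function space into \<open>A\<close> inside the one into \<open>D\<close>, so
  that the isomorphism known for \<open>D\<close> can be restricted.\<close>

lemma carrier_scott_fun_subdcpo:
  "carrier (scott_fun B (D\<lparr>carrier := A\<rparr>)) = {f \<in> carrier (scott_fun B D). f ` carrier B \<subseteq> A}"
  using A by (auto simp: scott_fun_def scott_continuous_subdcpo_iff PiE_iff)

end

section \<open>Restricting the extension isomorphism to a Skula closed subset\<close>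

theorem theorem4p6:
  fixes D :: "'d gorder" and A :: "'d set"
  assumes "R2 TYPE('u) D"
    and "A \<subseteq> carrier D"
    and "closedin (skula_topology (scott_topology D)) A"
  shows "R2 TYPE('u) (D\<lparr>carrier := A\<rparr>)"
proof -
  let ?A = "D\<lparr>carrier := A\<rparr>"
  have D: "dcpo D" and po: "partial_order D" using assms(1) unfolding R2_def dcpo_def by auto
  have "\<forall>S s. directed D S \<and> S \<subseteq> A \<and> is_lub D s S \<longrightarrow> s \<in> A"
    using skula_closed_directed_sup[OF po assms(3)] by blast
  note sub = D assms(2) this
  have dcpoA: "dcpo ?A" using dcpo_subdcpo[OF sub] .
  then have poA: "partial_order ?A" unfolding dcpo_def by blast
  have "dcpo_iso (scott_fun Y ?A) (scott_fun X ?A) (precomp X e)"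
    if e: "E2 X Y e" for X Y :: "'u gorder" and e
  proof -
    have ec: "scott_continuous X Y e" using e unfolding E2_def by blast
    have "dcpo_iso (scott_fun Y D) (scott_fun X D) (precomp X e)"
      using assms(1) e unfolding R2_def by blast
    \<comment> \<open>\<open>surj\<close> provides the extension of a map along \<open>e\<close>;
      \<open>emb\<close> is the order embedding that will be inherited by maps into
      \<open>A\<close>.\<close>
    then have surj: "precomp X e ` carrier (scott_fun Y D) = carrier (scott_fun X D)"
      and emb: "\<And>g h. g \<in> carrier (scott_fun Y D) \<Longrightarrow> h \<in> carrier (scott_fun Y D) \<Longrightarrow>
        g \<sqsubseteq>\<^bsub>scott_fun Y D\<^esub> h \<longleftrightarrow> precomp X e g \<sqsubseteq>\<^bsub>scott_fun X D\<^esub> precomp X e h"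
      unfolding dcpo_iso_iff[OF partial_order_scott_fun[OF po]] by auto
    have "f \<in> precomp X e ` carrier (scott_fun Y ?A)" if f: "f \<in> carrier (scott_fun X ?A)" for f
    proof -
      have fD: "f \<in> carrier (scott_fun X D)" and fA: "f ` carrier X \<subseteq> A"
        using f unfolding carrier_scott_fun_subdcpo[OF sub] by auto
      obtain g where g: "g \<in> carrier (scott_fun Y D)" and fg: "f = precomp X e g"
        using fD surj by blast
      have gc: "scott_continuous Y D g" using g by (simp add: scott_fun_def)
      have "g y \<in> A" if y: "y \<in> carrier Y" for y
      proof (rule ccontr)
        assume "g y \<notin> A"
        moreover have "g y \<in> carrier D" using gc y unfolding scott_continuous_def by auto
        ultimately obtain U V where UV: "scott_open D U" "scott_open D V"
          and yUV: "g y \<in> U" "g y \<notin> V" and AUV: "A \<inter> U \<subseteq> V"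
          using skula_closed_separation[OF po assms(3)] by blast
        have "{y \<in> carrier Y. g y \<in> U} \<subseteq> {y \<in> carrier Y. g y \<in> V}"
        proof (rule E2_scott_open_subset[OF e])
          fix x assume x: "x \<in> carrier X" "e x \<in> {y \<in> carrier Y. g y \<in> U}"
          \<comment> \<open>This value is \<open>f x\<close>, since \<open>g\<close> extends
            \<open>f\<close> along \<open>e\<close>. Values of \<open>g\<close> on the image of
            \<open>e\<close> therefore satisfy the inclusion \<open>AUV\<close>.\<close>
          have "g (e x) \<in> A" using fA x(1) fg by (auto simp: precomp_def compose_def)
          then show "e x \<in> {y \<in> carrier Y. g y \<in> V}" using x(2) AUV by blast
        qed (use scott_open_vimage[OF gc] UV in auto)
        then show False using y yUV by blast
      qed
      then have "g \<in> carrier (scott_fun Y ?A)"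
        using g unfolding carrier_scott_fun_subdcpo[OF sub] by blast
      then show ?thesis using fg by blast
    qed
    then have "precomp X e ` carrier (scott_fun Y ?A) = carrier (scott_fun X ?A)"
      using precomp_in_carrier[OF ec] by blast
    \<comment> \<open>Maps into \<open>A\<close> carry the same pointwise order as maps into
      \<open>D\<close>, so \<open>emb\<close> restricts directly.\<close>
    moreover have "g \<sqsubseteq>\<^bsub>scott_fun Y ?A\<^esub> h \<longleftrightarrow> precomp X e g \<sqsubseteq>\<^bsub>scott_fun X ?A\<^esub> precomp X e h"
      if "g \<in> carrier (scott_fun Y ?A)" "h \<in> carrier (scott_fun Y ?A)" for g h
      using emb[of g h] that unfolding carrier_scott_fun_subdcpo[OF sub]
      by (simp add: scott_fun_def)
    ultimately show ?thesis
      unfolding dcpo_iso_iff[OF partial_order_scott_fun[OF poA]] by blast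
  qed
  then show ?thesis using dcpoA unfolding R2_def by blast
qed

end
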